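(* Let $f\in V^*$, $u_h\in U_h$, and let $B:U\to V^*$ be a bounded linear operator. Suppose $\mathcal{M}_n$ is a finite-dimensional residual test set (e.g. a set of shallow ReLU network functions). Then the optimal residual $r_n^*\in\mathcal{M}_n$ defined by $$r_n^*=\arg\sup_{v_n\in\mathcal{M}_n}\frac{\langle f-Bu_h,v_n\rangle}{\|v_n\|}$$ subject to the normalization $\|r_n^*\|^2=\langle f-Bu_h,r_n^*\rangle$, is the solution of the unconstrained minimization problem $$r_n^*=\arg\min_{v_n\in\mathcal{M}_n}\left(\tfrac12\|v_n\|^2-\langle f-Bu_h,v_n\rangle\right).$$
   Context: $U$ and $V$ are Hilbert spaces, $V^*$ is the dual of $V$, $U_h\subset U$ is a finite-dimensional linear subspace, $\mathcal{M}_n\subset V$ is a set of functions parameterized by a neural network, $\langle\cdot,\cdot\rangle$ is the duality pairing between $V^*$ and $V$, and $\|\cdot\|=\|\cdot\|_V$. The quotient in the supremum is understood for $v_n\neq0$. *)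

theory Defs
  imports "HOL-Analysis.Analysis"
begin

definition dual_quotient :: "('v::real_normed_vector \<Rightarrow>\<^sub>L real) \<Rightarrow> 'v \<Rightarrow> real" where
  "dual_quotient g v = blinfun_apply g v / norm v"

(* The zero vector is excluded explicitly: x / 0 = 0 in HOL would otherwise let it
   compete in the maximisation. *)
definition optimal_residual ::
    "('v::real_normed_vector \<Rightarrow>\<^sub>L real) \<Rightarrow> 'v set \<Rightarrow> 'v \<Rightarrow> bool" where
  "optimal_residual g M r \<longleftrightarrow>
     is_arg_max (dual_quotient g) (\<lambda>v. v \<in> M \<and> v \<noteq> 0) r \<and>
     (norm r)\<^sup>2 = blinfun_apply g r"

definition residual_energy :: "('v::real_normed_vector \<Rightarrow>\<^sub>L real) \<Rightarrow> 'v \<Rightarrow> real" where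
  "residual_energy g v = 1 / 2 * (norm v)\<^sup>2 - blinfun_apply g v"

end

theory Submission imports Defs begin

text \<open>With \<open>g = f - B u\<^sub>h\<close>, the normalization makes the maximal quotient equal to
  \<open>\<parallel>r\<parallel>\<close>, so \<open>g v \<le> \<parallel>r\<parallel> \<parallel>v\<parallel>\<close> on the test set. Completing the square,
  the energy of \<open>v\<close> is at least \<open>(\<parallel>v\<parallel> - \<parallel>r\<parallel>)\<^sup>2 / 2 - \<parallel>r\<parallel>\<^sup>2 / 2\<close>, where \<open>- \<parallel>r\<parallel>\<^sup>2 / 2\<close> is the
  energy of \<open>r\<close>. Equality forces \<open>\<parallel>v\<parallel> = \<parallel>r\<parallel>\<close> and \<open>g v = \<parallel>r\<parallel> \<parallel>v\<parallel>\<close>, that is,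
  \<open>v\<close> is again a normalized maximizer.\<close>

lemma optimal_residual_iff:
  "optimal_residual g M r \<longleftrightarrow>
     r \<in> M \<and> r \<noteq> 0 \<and> (norm r)\<^sup>2 = blinfun_apply g r \<and>
     (\<forall>v\<in>M. blinfun_apply g v \<le> norm r * norm v)"
proof -
  have quot: "dual_quotient g r = norm r" if "r \<noteq> 0" "(norm r)\<^sup>2 = blinfun_apply g r"
    using that by (simp add: dual_quotient_def power2_eq_square flip: that(2))
  have le: "dual_quotient g v \<le> c \<longleftrightarrow> blinfun_apply g v \<le> c * norm v" if "v \<noteq> 0" for v c
    using that by (simp add: dual_quotient_def divide_le_eq)
  \<comment> \<open>The product bound is trivial at \<open>0\<close>, so it may range over all of
    \<open>M\<close> although the quotient omits \<open>0\<close>.\<close>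
  have zero: "blinfun_apply g 0 \<le> norm r * norm (0::'a)"
    by (simp add: blinfun.zero_right)
  show ?thesis
    unfolding optimal_residual_def is_arg_max_def
    using quot le zero by (metis not_less)
qed

text \<open>An exact identity rather than an estimate, so that the equality case can be read off as
  well.\<close>

lemma energy_gap_eq:
  assumes "(norm r)\<^sup>2 = blinfun_apply g r"
  shows "residual_energy g v - residual_energy g r =
    (norm v - norm r)\<^sup>2 / 2 + (norm r * norm v - blinfun_apply g v)"
  by (simp add: residual_energy_def power2_diff field_simps flip: assms)

lemma optimal_residual_is_arg_min:
  assumes "optimal_residual g M r"
  shows "is_arg_min (residual_energy g) (\<lambda>v. v \<in> M) r"
proof -
  have "residual_energy g r \<le> residual_energy g v" if "v \<in> M" for v
  proof -
    have "0 \<le> (norm v - norm r)\<^sup>2 / 2" "blinfun_apply g v \<le> norm r * norm v"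
      using assms that by (simp_all add: optimal_residual_iff)
    then show ?thesis
      using energy_gap_eq[of r g v] assms unfolding optimal_residual_iff by linarith
  qed
  then show ?thesis
    using assms by (auto simp: is_arg_min_linorder optimal_residual_iff)
qed

text \<open>\<open>M\<close> need not be convex, so there may be several minimizers; this covers all
  of them.\<close>

lemma is_arg_min_optimal_residual:
  assumes r: "optimal_residual g M r"
    and s: "is_arg_min (residual_energy g) (\<lambda>v. v \<in> M) s"
  shows "optimal_residual g M s"
proof -
  have "s \<in> M" "residual_energy g s \<le> residual_energy g r"
    using r s by (auto simp: is_arg_min_linorder optimal_residual_iff)
  moreover have "0 \<le> (norm s - norm r)\<^sup>2 / 2" "blinfun_apply g s \<le> norm r * norm s"
    using r \<open>s \<in> M\<close> by (simp_all add: optimal_residual_iff)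
  ultimately have "(norm s - norm r)\<^sup>2 / 2 = 0" and gs: "blinfun_apply g s = norm r * norm s"
    using energy_gap_eq[of r g s] r unfolding optimal_residual_iff by linarith+
  then have "norm s = norm r"
    by simp
  \<comment> \<open>The bound sees \<open>r\<close> only through \<open>norm r\<close>, and
    \<open>r \<noteq> 0\<close> passes to \<open>s\<close> by equality of norms.\<close>
  then show ?thesis
    using r gs \<open>s \<in> M\<close> by (auto simp: optimal_residual_iff power2_eq_square)
qed

theorem lemma1:
  fixes U\<^sub>h :: "'u::{real_inner, banach} set"
    and u\<^sub>h :: 'u
    and f :: "'v::{real_inner, banach} \<Rightarrow>\<^sub>L real"
    and B :: "'u \<Rightarrow>\<^sub>L ('v \<Rightarrow>\<^sub>L real)"
    and \<Phi> :: "real ^ 'p \<Rightarrow> 'v"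
    and \<Theta> :: "(real ^ 'p) set"
    and M\<^sub>n :: "'v set"
    and r :: 'v
  assumes "subspace U\<^sub>h" and "\<exists>S. finite S \<and> span S = U\<^sub>h"
    and "u\<^sub>h \<in> U\<^sub>h"
    and "M\<^sub>n = \<Phi> ` \<Theta>"
    and "optimal_residual (f - blinfun_apply B u\<^sub>h) M\<^sub>n r"
  shows "is_arg_min (residual_energy (f - blinfun_apply B u\<^sub>h)) (\<lambda>v. v \<in> M\<^sub>n) r \<and>
    (\<forall>s. is_arg_min (residual_energy (f - blinfun_apply B u\<^sub>h)) (\<lambda>v. v \<in> M\<^sub>n) s \<longrightarrow>
         optimal_residual (f - blinfun_apply B u\<^sub>h) M\<^sub>n s)"
  using optimal_residual_is_arg_min is_arg_min_optimal_residual assms(5) by blast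

end
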